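(* Let $X$ be a normed vector space over $\mathbb{K}\in\{\mathbb{R},\mathbb{C}\}$, let $m\in\mathbb{N}$, $p\in(0,\infty)$ and $\mu\in\mathbb{N}$ with $\mu\geq 1$. Let $T=(T_1,T_2)\in B(X)^2$ be a commuting pair of bounded linear operators which is both an $(m,p)$-isometry and a $(\mu,\infty)$-isometry. Then either $T_1^m$ is an isometry and $T_2^m=0$, or vice versa (i.e. $T_2^m$ is an isometry and $T_1^m=0$).
   Context: $\mathbb{N}$ denotes the natural numbers including $0$. $B(X)$ is the algebra of bounded linear operators on $X$. For a multi-index $\alpha=(\alpha_1,\alpha_2)\in\mathbb{N}^2$ put $|\alpha|=\alpha_1+\alpha_2$, $\alpha!=\alpha_1!\alpha_2!$, and $T^\alpha=T_1^{\alpha_1}T_2^{\alpha_2}$, where $T_j^0=I$ is the identity. A commuting pair $T=(T_1,T_2)$ of linear operators on $X$ is an $(m,p)$-isometry (or $(m,p)$-isometric pair), for $m\in\mathbb{N}$ and $p\in(0,\infty)$, if $$\sum_{k=0}^m(-1)^{m-k}\binom{m}{k}\sum_{|\alpha|=k}\frac{k!}{\alpha!}\|T^\alpha x\|^p=0\quad\text{for all }x\in X.$$ A commuting pair $T\in B(X)^2$ is a $(\mu,\infty)$-isometry (or $(\mu,\infty)$-isometric pair), for $\mu\in\mathbb{N}$, $\mu\geq 1$, if $$\max_{0\leq|\alpha|\leq\mu,\ |\alpha|\text{ even}}\|T^\alpha x\|=\max_{0\leq|\alpha|\leq\mu,\ |\alpha|\text{ odd}}\|T^\alpha x\|\quad\text{for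 all }x\in X.$$ *)

theory Defs
  imports Complex_Main
begin

text \<open>
  Normed spaces over \<open>\<K>\<close>, the reals or the complex numbers. The scalar field is a type of class
  \<^class>\<open>real_normed_field\<close>; both \<^typ>\<open>real\<close> and \<^typ>\<open>complex\<close> are instances, and by the theorem of
  Ostrowski (Gelfand-Mazur) every instance is isometrically isomorphic to one of them. The axiom
  \<open>scale_of_real\<close> says that the real structure carried by the type class is the one obtained from
  \<open>scale\<close> by restriction of scalars.
\<close>

locale normed_space_over = vector_space scale
  for scale :: "'k::real_normed_field \<Rightarrow> 'a::real_normed_vector \<Rightarrow> 'a" +
  assumes scale_of_real: "scale (of_real r) x = r *\<^sub>R x"
    and norm_scale: "norm (scale c x) = norm c * norm x"

lemma normed_space_over_scaleR:
  "normed_space_over (scaleR :: real \<Rightarrow> 'a::real_normed_vector \<Rightarrow> 'a)"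
  by unfold_locales (simp_all add: scaleR_add_right scaleR_add_left)

lemma normed_space_over_complex:
  "normed_space_over ((*) :: complex \<Rightarrow> complex \<Rightarrow> complex)"
  by unfold_locales (simp_all add: algebra_simps norm_mult scaleR_conv_of_real)

definition bounded_operator ::
    "('k::real_normed_field \<Rightarrow> 'a::real_normed_vector \<Rightarrow> 'a) \<Rightarrow> ('a \<Rightarrow> 'a) \<Rightarrow> bool" where
  "bounded_operator scale S \<longleftrightarrow>
     Vector_Spaces.linear scale scale S \<and> (\<exists>C. \<forall>x. norm (S x) \<le> C * norm x)"

type_synonym multi_index = "nat \<times> nat"

definition mi_abs :: "multi_index \<Rightarrow> nat" where
  "mi_abs \<alpha> = fst \<alpha> + snd \<alpha>"

definition mi_fact :: "multi_index \<Rightarrow> nat" where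
  "mi_fact \<alpha> = fact (fst \<alpha>) * fact (snd \<alpha>)"

definition op_pow :: "('a \<Rightarrow> 'a) \<times> ('a \<Rightarrow> 'a) \<Rightarrow> multi_index \<Rightarrow> 'a \<Rightarrow> 'a" where
  "op_pow T \<alpha> = (fst T ^^ fst \<alpha>) \<circ> (snd T ^^ snd \<alpha>)"

definition commuting_pair :: "('a \<Rightarrow> 'a) \<times> ('a \<Rightarrow> 'a) \<Rightarrow> bool" where
  "commuting_pair T \<longleftrightarrow> fst T \<circ> snd T = snd T \<circ> fst T"

definition mp_isometric_pair ::
    "('k::real_normed_field \<Rightarrow> 'a::real_normed_vector \<Rightarrow> 'a) \<Rightarrow> nat \<Rightarrow> real
       \<Rightarrow> ('a \<Rightarrow> 'a) \<times> ('a \<Rightarrow> 'a) \<Rightarrow> bool" where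
  "mp_isometric_pair scale m p T \<longleftrightarrow>
     Vector_Spaces.linear scale scale (fst T) \<and> Vector_Spaces.linear scale scale (snd T) \<and>
     commuting_pair T \<and>
     (\<forall>x. (\<Sum>k=0..m. (-1) ^ (m - k) * real (m choose k) *
             (\<Sum>\<alpha> | mi_abs \<alpha> = k. fact k / real (mi_fact \<alpha>) * norm (op_pow T \<alpha> x) powr p)) = 0)"

definition mu_inf_isometric_pair ::
    "('k::real_normed_field \<Rightarrow> 'a::real_normed_vector \<Rightarrow> 'a) \<Rightarrow> nat
       \<Rightarrow> ('a \<Rightarrow> 'a) \<times> ('a \<Rightarrow> 'a) \<Rightarrow> bool" where
  "mu_inf_isometric_pair scale \<mu> T \<longleftrightarrow>
     bounded_operator scale (fst T) \<and> bounded_operator scale (snd T) \<and> commuting_pair T \<and>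
     (\<forall>x. Max {norm (op_pow T \<alpha> x) |\<alpha>. mi_abs \<alpha> \<le> \<mu> \<and> even (mi_abs \<alpha>)} =
          Max {norm (op_pow T \<alpha> x) |\<alpha>. mi_abs \<alpha> \<le> \<mu> \<and> odd (mi_abs \<alpha>)})"

text \<open>The index sets of the sums and maxima above are finite, so both have their usual meaning.\<close>

lemma finite_mi_abs_le: "finite {\<alpha>. mi_abs \<alpha> \<le> n}"
  by (rule finite_subset[of _ "{..n} \<times> {..n}"]) (auto simp: mi_abs_def)

lemma finite_mi_abs_eq: "finite {\<alpha>. mi_abs \<alpha> = k}"
  by (rule finite_subset[OF _ finite_mi_abs_le[of k]]) auto

definition isometric :: "('a::real_normed_vector \<Rightarrow> 'a) \<Rightarrow> bool" where
  "isometric S \<longleftrightarrow> (\<forall>x. norm (S x) = norm x)"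

end

theory Submission imports Defs begin

text \<open>
  Write \<open>A\<close>, \<open>B\<close> for the two operators and put
  \<open>Q n x = (\<Sum>j\<le>n. (n choose j) * norm (A\<^sup>j B\<^sup>n\<^sup>-\<^sup>j x) powr p)\<close>. The two hypotheses enter as follows.

  The \<open>(m, p)\<close> condition says that the \<open>m\<close>-th difference of \<open>n \<mapsto> Q n x\<close> vanishes at \<open>0\<close>. Since
  \<open>Q (n + 1) x = Q n (A x) + Q n (B x)\<close>, it then vanishes everywhere, so \<open>Q n x\<close> is a polynomial in
  \<open>n\<close> of degree below \<open>m\<close>.

  The \<open>(\<mu>, \<infinity>)\<close> condition produces a larger norm-like function
  \<open>|x| = max {norm (A\<^sup>i B\<^sup>j x) | i + j \<le> \<mu>}\<close> with \<open>|x| = max |A x| |B x|\<close>. Iterating this \<open>2n\<close> times,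
  one of the two exponents reaches \<open>n\<close>, hence \<open>|x| = max |A\<^sup>n x| |B\<^sup>n x|\<close> for every \<open>n\<close>.

  Now the two are played against each other. The summand of \<open>Q (n + m) x\<close> that belongs to \<open>A\<^sup>m B\<^sup>n\<close>
  carries a weight of order \<open>n\<^sup>m\<close>, while \<open>Q\<close> grows more slowly; so \<open>A\<^sup>m B\<^sup>n x\<close> tends to \<open>0\<close>, and
  likewise \<open>B\<^sup>m A\<^sup>n x\<close>. The maximum formula applied to \<open>A\<^sup>m B\<^sup>m x\<close> gives \<open>A\<^sup>m B\<^sup>m = 0\<close>
  (\<open>mixed_power_zero\<close>).

  Let \<open>u \<in> ker B\<^sup>m\<close> and \<open>v \<in> ker A\<^sup>m\<close>. Then \<open>Q n (u + v) = Q n u + Q n v\<close> for \<open>n \<ge> 2m\<close>, because each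
  word of length \<open>n\<close> kills \<open>u\<close> or \<open>v\<close>; by polynomiality this persists down to \<open>n = 0\<close>, that is,
  \<open>norm (u + v) powr p = norm u powr p + norm v powr p\<close> (\<open>norm_powr_additive\<close>). On the other hand
  \<open>|u + v| \<le> max |u| |v|\<close>. A \<open>p\<close>-sum and a maximum are incompatible unless one of the kernels is
  zero (\<open>kernel_trivial\<close>), and together with \<open>A\<^sup>m B\<^sup>m = 0\<close> this forces \<open>A\<^sup>m = 0\<close> or \<open>B\<^sup>m = 0\<close>.

  If \<open>B\<^sup>m = 0\<close>, then \<open>A\<close> preserves the norm on \<open>ker B\<^sup>k\<close> for all \<open>k\<close>, by induction on \<open>k\<close>: on
  \<open>ker B\<^sup>k\<^sup>+\<^sup>1\<close> all summands of \<open>Q n (A x) - Q n x\<close> cancel except those without \<open>B\<close>, so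
  \<open>norm (A\<^sup>n x) powr p\<close> is a polynomial in \<open>n\<close>; being bounded by \<open>|x| powr p\<close>, it is constant
  (\<open>norm_pow_eq_on_kernel\<close>). For \<open>k = m\<close> this makes \<open>A\<close>, hence \<open>A\<^sup>m\<close>, an isometry.
\<close>

section \<open>Binomial sums and polynomial sequences\<close>

definition binomial_sum :: "(nat \<Rightarrow> nat \<Rightarrow> real) \<Rightarrow> nat \<Rightarrow> real" where
  "binomial_sum \<phi> n = (\<Sum>j\<le>n. real (n choose j) * \<phi> j (n - j))"

text \<open>
  Pascal's rule. Both the sums \<open>Q n x\<close> and iterated differences of a sequence have the form
  \<^const>\<open>binomial_sum\<close>, so this one recursion serves for both.
\<close>

lemma binomial_sum_Suc:
  "binomial_sum \<phi> (Suc n) =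
     binomial_sum (\<lambda>j k. \<phi> (Suc j) k) n + binomial_sum (\<lambda>j k. \<phi> j (Suc k)) n"
proof -
  have "binomial_sum \<phi> (Suc n) = \<phi> 0 (Suc n) +
      (\<Sum>j\<le>n. real (Suc n choose Suc j) * \<phi> (Suc j) (n - j))"
    unfolding binomial_sum_def by (subst sum.atMost_Suc_shift) simp
  also have "\<dots> = \<phi> 0 (Suc n) + (\<Sum>j\<le>n. real (n choose Suc j) * \<phi> (Suc j) (n - j))
      + (\<Sum>j\<le>n. real (n choose j) * \<phi> (Suc j) (n - j))"
    by (simp add: algebra_simps sum.distrib)
  also have "\<phi> 0 (Suc n) + (\<Sum>j\<le>n. real (n choose Suc j) * \<phi> (Suc j) (n - j)) =
      (\<Sum>j\<le>Suc n. real (n choose j) * \<phi> j (Suc n - j))"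
    by (subst sum.atMost_Suc_shift) simp
  also have "\<dots> = (\<Sum>j\<le>n. real (n choose j) * \<phi> j (Suc (n - j)))"
    by (simp add: Suc_diff_le)
  finally show ?thesis
    by (simp add: binomial_sum_def)
qed

lemma binomial_sum_add:
  "binomial_sum (\<lambda>j k. \<phi> j k + \<psi> j k) n = binomial_sum \<phi> n + binomial_sum \<psi> n"
  by (simp add: binomial_sum_def algebra_simps sum.distrib)

lemma binomial_sum_cong:
  assumes "\<And>j k. j + k = n \<Longrightarrow> \<phi> j k = \<psi> j k"
  shows "binomial_sum \<phi> n = binomial_sum \<psi> n"
  unfolding binomial_sum_def by (intro sum.cong) (auto simp: assms)

text \<open>
  The sequences whose \<open>m\<close>-th difference vanishes, i.e. the polynomials in \<open>n\<close> of degree less than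
  \<open>m\<close>. The recursive form lets every property below be proved by passing to the difference sequence.
\<close>

primrec polynomial_seq :: "nat \<Rightarrow> (nat \<Rightarrow> real) \<Rightarrow> bool" where
  "polynomial_seq 0 f \<longleftrightarrow> (\<forall>n. f n = 0)"
| "polynomial_seq (Suc m) f \<longleftrightarrow> polynomial_seq m (\<lambda>n. f (Suc n) - f n)"

lemma polynomial_seq_diff:
  "polynomial_seq m f \<Longrightarrow> polynomial_seq m g \<Longrightarrow> polynomial_seq m (\<lambda>n. f n - g n)"
proof (induction m arbitrary: f g)
  case (Suc m)
  from Suc.IH[OF Suc.prems[simplified]] show ?case
    by (simp add: algebra_simps)
qed simp

text \<open>
  The hypothesis is the closed form of the \<open>m\<close>-th difference; with \<open>\<phi> j k = (-1)\<^sup>k f (n + j)\<close> Pascal's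
  rule turns it into the \<open>(m - 1)\<close>-st difference of \<open>f (n + 1) - f n\<close>.
\<close>

lemma polynomial_seq_if_alternating_sums_vanish:
  assumes "\<And>n. binomial_sum (\<lambda>j k. (-1) ^ k * f (n + j)) m = 0"
  shows "polynomial_seq m f"
  using assms
proof (induction m arbitrary: f)
  case 0
  then show ?case by (simp add: binomial_sum_def)
next
  case (Suc m)
  have "binomial_sum (\<lambda>j k. (-1) ^ k * (f (Suc (n + j)) - f (n + j))) m = 0" for n
    using Suc.prems[of n]
    by (simp add: binomial_sum_Suc binomial_sum_add[symmetric] algebra_simps)
  then show ?case
    using Suc.IH[of "\<lambda>n. f (Suc n) - f n"] by simp
qed

lemma polynomial_seq_eventually_zero:
  assumes "polynomial_seq m f" "\<And>n. n \<ge> N \<Longrightarrow> f n = 0"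
  shows "f n = 0"
  using assms
proof (induction m arbitrary: f n)
  case (Suc m)
  have step: "f (Suc i) - f i = 0" for i
    using Suc.IH[of "\<lambda>n. f (Suc n) - f n" i] Suc.prems by simp
  have "f n = f (n + i)" for i
    by (induction i) (use step in auto)
  from this[of N] show ?case
    using Suc.prems(2) by simp
qed simp

lemma polynomial_seq_bounded_const:
  assumes "polynomial_seq m f" "\<And>n. \<bar>f n\<bar> \<le> C"
  shows "f n = f 0"
  using assms
proof (induction m arbitrary: f C n)
  case (Suc m)
  define c where "c = f 1 - f 0"
  have bd: "\<bar>f (Suc i) - f i\<bar> \<le> 2 * C" for i
    using Suc.prems(2)[of i] Suc.prems(2)[of "Suc i"] by linarith
  have "f (Suc i) - f i = c" for i
    using Suc.IH[of "\<lambda>n. f (Suc n) - f n" "2 * C" i] Suc.prems(1) bd by (simp add: c_def)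
  then have step: "f (Suc i) = f i + c" for i
    by (metis diff_eq_eq add.commute)
  have lin: "f i = f 0 + real i * c" for i
    by (induction i) (simp_all add: step algebra_simps)
  have "c = 0"
  proof (rule ccontr)
    assume "c \<noteq> 0"
    then obtain i where "2 * C < real i * \<bar>c\<bar>"
      using reals_Archimedean3[of "\<bar>c\<bar>"] by auto
    moreover have "real i * \<bar>c\<bar> = \<bar>f i - f 0\<bar>"
      by (simp add: lin[of i] abs_mult)
    ultimately show False
      using Suc.prems(2)[of i] Suc.prems(2)[of 0] by linarith
  qed
  then show ?case
    using lin[of n] by simp
qed simp

text \<open>
  Summing the bound on the differences costs one factor \<open>n\<close>, so a polynomial of degree at most \<open>m\<close>
  is of order \<open>n\<^sup>m\<close>.
\<close>

lemma polynomial_seq_growth: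
  assumes "polynomial_seq (Suc m) f"
  shows "\<exists>K\<ge>0. \<forall>n. \<bar>f n\<bar> \<le> K * real (Suc n) ^ m"
  using assms
proof (induction m arbitrary: f)
  case 0
  then have "f n = f 0" for n
    by (induction n) auto
  then show ?case
    by (intro exI[of _ "\<bar>f 0\<bar>"]) (simp, metis order_refl)
next
  case (Suc m)
  obtain K where K: "K \<ge> 0" "\<And>n. \<bar>f (Suc n) - f n\<bar> \<le> K * real (Suc n) ^ m"
    using Suc.IH[of "\<lambda>n. f (Suc n) - f n"] Suc.prems by auto
  have "\<bar>f n\<bar> \<le> (\<bar>f 0\<bar> + K) * real (Suc n) ^ Suc m" for n
  proof -
    have sum: "\<bar>f i\<bar> \<le> \<bar>f 0\<bar> + real i * (K * real (Suc n) ^ m)" if "i \<le> n" for i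
      using that
    proof (induction i)
      case (Suc i)
      have "K * real (Suc i) ^ m \<le> K * real (Suc n) ^ m"
        using Suc.prems K(1) by (intro mult_left_mono power_mono) auto
      then have "\<bar>f (Suc i) - f i\<bar> \<le> K * real (Suc n) ^ m"
        using K(2)[of i] by linarith
      moreover have "real (Suc i) * (K * real (Suc n) ^ m) =
          real i * (K * real (Suc n) ^ m) + K * real (Suc n) ^ m"
        by (simp add: algebra_simps)
      ultimately show ?case
        using Suc.IH Suc.prems by linarith
    qed simp
    have "\<bar>f 0\<bar> * 1 \<le> \<bar>f 0\<bar> * real (Suc n) ^ Suc m"
      by (intro mult_left_mono one_le_power) auto
    moreover have "real n * (K * real (Suc n) ^ m) \<le> real (Suc n) * (K * real (Suc n) ^ m)"
      using K(1) by (intro mult_right_mono) auto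
    ultimately show ?thesis
      using sum[of n] by (simp add: algebra_simps)
  qed
  then show ?case
    using K(1) by (intro exI[of _ "\<bar>f 0\<bar> + K"]) auto
qed

text \<open>
  The weight \<open>(n + m) choose m\<close> has degree \<open>m\<close> in \<open>n\<close>, one more than \<open>f\<close> can have. This is what
  makes the mixed powers \<open>A\<^sup>m B\<^sup>n\<close> vanish in the limit.
\<close>

lemma polynomial_seq_over_binomial_tendsto_0:
  assumes "polynomial_seq m f"
  shows "(\<lambda>n. f (n + m) / real (n + m choose m)) \<longlonglongrightarrow> 0"
proof (cases m)
  case 0
  then show ?thesis using assms by simp
next
  case (Suc l)
  obtain K where K: "K \<ge> 0" "\<And>n. \<bar>f n\<bar> \<le> K * real (Suc n) ^ l"
    using polynomial_seq_growth[of l f] assms Suc by auto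
  \<comment> \<open>The factor \<open>2\<^sup>l\<close> absorbs \<open>n + m + 1 \<le> 2 (n + m)\<close>, and \<open>m\<^sup>m\<close> comes from the lower bound
    \<open>((n + m) / m)\<^sup>m\<close> for the binomial coefficient.\<close>
  define L where "L = K * 2 ^ l * real m ^ m"
  have bound: "norm (f (n + m) / real (n + m choose m)) \<le> L / real (n + m)" for n
  proof -
    have pos: "real (n + m) > 0" "real m > 0"
      using Suc by auto
    have choose_pos: "real (n + m choose m) > 0"
      by simp
    have choose: "(real (n + m) / real m) ^ m \<le> real (n + m choose m)"
      using binomial_ge_n_over_k_pow_k[of m "n + m", where 'a = real] by simp
    have "\<bar>f (n + m)\<bar> \<le> K * (2 * real (n + m)) ^ l"
      by (rule order_trans[OF K(2)], intro mult_left_mono power_mono) (use Suc K(1) in auto)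
    also have "\<dots> = L / real (n + m) * (real (n + m) / real m) ^ m"
    proof -
      have "K * (2 * y) ^ l = K * 2 ^ l * z ^ Suc l / y * (y / z) ^ Suc l" if "y > 0" "z > 0" for y z :: real
        using that by (simp add: power_mult_distrib power_divide)
      from this[OF pos] show ?thesis
        by (simp only: L_def Suc)
    qed
    also have "\<dots> \<le> L / real (n + m) * real (n + m choose m)"
      using choose K(1) by (intro mult_left_mono) (auto simp: L_def)
    finally show ?thesis
      using choose_pos by (simp add: divide_le_eq del: zero_less_binomial)
  qed
  have "(\<lambda>n. L / real (n + m)) \<longlonglongrightarrow> 0"
    using LIMSEQ_ignore_initial_segment[OF lim_const_over_n[of L], of m] by simp
  then have "(\<lambda>n. norm (f (n + m) / real (n + m choose m))) \<longlonglongrightarrow> 0"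
    by (rule tendsto_sandwich[OF _ _ tendsto_const, rotated 2])
      (rule always_eventually, rule allI, rule norm_ge_zero bound)+
  then show ?thesis
    by (rule tendsto_norm_zero_cancel)
qed

section \<open>Powers of commuting maps\<close>

text \<open>
  The sums \<open>Q n x\<close> over all words of length \<open>n\<close> in \<open>A\<close> and \<open>B\<close>. The recursion makes the symmetry
  in \<open>A\<close> and \<open>B\<close> and the passage from \<open>n\<close> to \<open>n + 1\<close> immediate; for commuting maps the words can be
  collected into a binomial sum.
\<close>

primrec orbit_sum :: "('a::real_normed_vector \<Rightarrow> 'a) \<Rightarrow> ('a \<Rightarrow> 'a) \<Rightarrow> real \<Rightarrow> nat \<Rightarrow> 'a \<Rightarrow> real" where
  "orbit_sum A B p 0 x = norm x powr p"
| "orbit_sum A B p (Suc n) x = orbit_sum A B p n (A x) + orbit_sum A B p n (B x)"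

lemma orbit_sum_commute: "orbit_sum A B p n x = orbit_sum B A p n x"
  by (induction n arbitrary: x) simp_all

lemma funpow_commute:
  assumes "\<And>x. A (B x) = B (A x)"
  shows "(A ^^ i) ((B ^^ j) x) = (B ^^ j) ((A ^^ i) x)"
proof -
  have one: "A ((B ^^ j) y) = (B ^^ j) (A y)" for y
    by (induction j) (simp_all add: assms)
  show ?thesis
    by (induction i) (simp_all add: one)
qed

lemma orbit_sum_eq_binomial_sum:
  assumes comm: "\<And>x. A (B x) = B (A x)"
  shows "orbit_sum A B p n x = binomial_sum (\<lambda>j k. norm ((A ^^ j) ((B ^^ k) x)) powr p) n"
proof (induction n arbitrary: x)
  case 0
  show ?case by (simp add: binomial_sum_def)
next
  case (Suc n)
  have "(A ^^ j) ((B ^^ k) (A x)) = (A ^^ Suc j) ((B ^^ k) x)" for j k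
    using funpow_commute[of A B 1 k x] comm by (simp add: funpow_swap1)
  moreover have "(A ^^ j) ((B ^^ k) (B x)) = (A ^^ j) ((B ^^ Suc k) x)" for j k
    by (simp add: funpow_swap1)
  ultimately show ?case
    by (simp only: orbit_sum.simps Suc.IH binomial_sum_Suc)
qed

text \<open>
  The hypothesis, the vanishing of the \<open>m\<close>-th difference at the index \<open>0\<close>, is required of all \<open>x\<close>;
  applied to \<open>A x\<close> and \<open>B x\<close> it moves the index from \<open>n\<close> to \<open>n + 1\<close>.
\<close>

lemma polynomial_seq_orbit_sum:
  assumes "\<And>x. binomial_sum (\<lambda>j k. (-1) ^ k * orbit_sum A B p j x) m = 0"
  shows "polynomial_seq m (\<lambda>n. orbit_sum A B p n x)"
proof (rule polynomial_seq_if_alternating_sums_vanish)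
  fix n
  show "binomial_sum (\<lambda>j k. (-1) ^ k * orbit_sum A B p (n + j) x) m = 0"
    by (induction n arbitrary: x) (simp_all add: assms algebra_simps binomial_sum_add)
qed

section \<open>Pairs with polynomial orbit sums and a maximum formula\<close>

text \<open>
  What remains of the two isometry conditions once the parities in the maxima have been used: \<open>supn\<close>
  stands for the function \<open>|x|\<close>, a finite maximum of the norms of \<open>A\<^sup>i B\<^sup>j x\<close>. The assumptions are
  symmetric in \<open>A\<close> and \<open>B\<close>, so that every result also holds with the two exchanged.
\<close>

locale polynomial_pair_with_sup_norm =
  fixes A B :: "'a::real_normed_vector \<Rightarrow> 'a"
    and p :: real and m :: nat
    and supn :: "'a \<Rightarrow> real" and I :: "(nat \<times> nat) set"
  assumes linA: "linear A" and linB: "linear B"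
    and comm: "A (B x) = B (A x)"
    and p_pos: "p > 0"
    and poly: "polynomial_seq m (\<lambda>n. orbit_sum A B p n x)"
    and finI: "finite I"
    and norm_le: "norm x \<le> supn x"
    and attained: "\<exists>(i, j) \<in> I. supn x = norm ((A ^^ i) ((B ^^ j) x))"
    and decrA: "supn (A x) \<le> supn x" and decrB: "supn (B x) \<le> supn x"
    and le_max: "supn x \<le> max (supn (A x)) (supn (B x))"
begin

lemma commute: "(A ^^ i) ((B ^^ j) x) = (B ^^ j) ((A ^^ i) x)"
  using funpow_commute comm by metis

lemma swap: "polynomial_pair_with_sup_norm B A p m supn (prod.swap ` I)"
proof (rule polynomial_pair_with_sup_norm.intro)
  show "\<exists>(i, j)\<in>prod.swap ` I. supn x = norm ((B ^^ i) ((A ^^ j) x))" for x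
    using attained[of x] by (force simp: commute)
  show "polynomial_seq m (\<lambda>n. orbit_sum B A p n x)" for x
    using poly[of x] by (simp add: orbit_sum_commute[of B A])
  show "supn x \<le> max (supn (B x)) (supn (A x))" for x
    using le_max[of x] by (simp add: max.commute)
  show "finite (prod.swap ` I)"
    using finI by simp
qed (rule linA linB comm[symmetric] p_pos norm_le decrA decrB)+

lemma linear_powers: "linear (A ^^ i)" "linear (B ^^ j)"
proof -
  have "linear (S ^^ n)" if "linear S" for S :: "'a \<Rightarrow> 'a" and n
    by (induction n) (simp_all add: that linear_id[unfolded id_def] linear_compose[unfolded comp_def] id_def)
  then show "linear (A ^^ i)" "linear (B ^^ j)"
    using linA linB by blast+
qed

lemma orbit_sum_eq:
  "orbit_sum A B p n x = binomial_sum (\<lambda>j k. norm ((A ^^ j) ((B ^^ k) x)) powr p) n"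
  using orbit_sum_eq_binomial_sum comm by metis

lemma decr_pow: "supn ((A ^^ i) x) \<le> supn x" "supn ((B ^^ j) x) \<le> supn x"
proof -
  show "supn ((A ^^ i) x) \<le> supn x"
    by (induction i) (auto intro: order_trans[OF decrA])
  show "supn ((B ^^ j) x) \<le> supn x"
    by (induction j) (auto intro: order_trans[OF decrB])
qed

lemma supn_attained_at_level: "\<exists>a b. a + b = N \<and> supn x \<le> supn ((A ^^ a) ((B ^^ b) x))"
proof (induction N)
  case (Suc N)
  then obtain a b where ab: "a + b = N" "supn x \<le> supn ((A ^^ a) ((B ^^ b) x))"
    by blast
  let ?y = "(A ^^ a) ((B ^^ b) x)"
  have "A ?y = (A ^^ Suc a) ((B ^^ b) x)" "B ?y = (A ^^ a) ((B ^^ Suc b) x)"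
    using commute[of a 1 "(B ^^ b) x"] by simp_all
  then have "supn x \<le> supn ((A ^^ Suc a) ((B ^^ b) x)) \<or> supn x \<le> supn ((A ^^ a) ((B ^^ Suc b) x))"
    using ab(2) le_max[of ?y] by (auto simp: max_def split: if_splits)
  then show ?case
    using ab(1) by (metis add_Suc add_Suc_right)
qed (auto intro: exI[of _ 0])

text \<open>
  Of two exponents with sum \<open>2n\<close> at least one is \<open>n\<close> or more, and the remaining powers can only
  decrease \<open>supn\<close>.
\<close>

lemma supn_le_max_pow: "supn x \<le> max (supn ((A ^^ n) x)) (supn ((B ^^ n) x))"
proof -
  obtain a b where ab: "a + b = n + n" "supn x \<le> supn ((A ^^ a) ((B ^^ b) x))"
    using supn_attained_at_level by blast
  show ?thesis
  proof (cases "a \<ge> n")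
    case True
    then have "(A ^^ a) ((B ^^ b) x) = (A ^^ (a - n)) ((B ^^ b) ((A ^^ n) x))"
      using commute[of n b x] by (metis comp_apply funpow_add le_add_diff_inverse2)
    then have "supn ((A ^^ a) ((B ^^ b) x)) \<le> supn ((A ^^ n) x)"
      using decr_pow order_trans by metis
    then show ?thesis using ab(2) by linarith
  next
    case False
    with ab(1) have "b \<ge> n" by simp
    then have "(A ^^ a) ((B ^^ b) x) = (A ^^ a) ((B ^^ (b - n)) ((B ^^ n) x))"
      by (metis comp_apply funpow_add le_add_diff_inverse2)
    then have "supn ((A ^^ a) ((B ^^ b) x)) \<le> supn ((B ^^ n) x)"
      using decr_pow order_trans by metis
    then show ?thesis using ab(2) by linarith
  qed
qed

text \<open>
  A single summand of \<open>Q (n + m) x\<close> is at most the whole sum, which has smaller order of growth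
  than its weight.
\<close>

lemma norm_mixed_powers_tendsto_0: "(\<lambda>n. norm ((A ^^ m) ((B ^^ n) x))) \<longlonglongrightarrow> 0"
proof -
  let ?q = "\<lambda>n. orbit_sum A B p (n + m) x / real (n + m choose m)"
  have le: "norm ((A ^^ m) ((B ^^ n) x)) powr p \<le> ?q n" for n
  proof -
    have "real (n + m choose m) * norm ((A ^^ m) ((B ^^ (n + m - m)) x)) powr p \<le> orbit_sum A B p (n + m) x"
      unfolding orbit_sum_eq binomial_sum_def
      by (rule member_le_sum) auto
    then show ?thesis
      by (simp add: pos_le_divide_eq mult.commute)
  qed
  have "(\<lambda>n. norm ((A ^^ m) ((B ^^ n) x)) powr p) \<longlonglongrightarrow> 0"
    by (rule tendsto_sandwich[OF _ _ tendsto_const polynomial_seq_over_binomial_tendsto_0[OF poly[of x]]])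
      (use le in auto)
  then have "(\<lambda>n. (norm ((A ^^ m) ((B ^^ n) x)) powr p) powr (1 / p)) \<longlonglongrightarrow> 0"
    by (rule tendsto_zero_powrI[where b = "1 / p"]) (use p_pos in auto)
  then show ?thesis
    using p_pos by (simp add: powr_powr)
qed

text \<open>
  Since \<open>supn\<close> is always attained at one of finitely many words in \<open>I\<close>, it is dominated by the sum
  over these words, and each of them commutes past \<open>A\<^sup>m B\<^sup>n\<close>.
\<close>

lemma supn_mixed_powers_tendsto_0: "(\<lambda>n. supn ((A ^^ m) ((B ^^ n) x))) \<longlonglongrightarrow> 0"
proof -
  let ?s = "\<lambda>n. \<Sum>(i, j)\<in>I. norm ((A ^^ m) ((B ^^ n) ((A ^^ i) ((B ^^ j) x))))"
  have "supn ((A ^^ m) ((B ^^ n) x)) \<le> ?s n" for n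
  proof -
    obtain i j where ij: "(i, j) \<in> I"
      "supn ((A ^^ m) ((B ^^ n) x)) = norm ((A ^^ i) ((B ^^ j) ((A ^^ m) ((B ^^ n) x))))"
      using attained by blast
    have "(A ^^ i) ((B ^^ j) ((A ^^ m) ((B ^^ n) x))) = (A ^^ m) ((B ^^ n) ((A ^^ i) ((B ^^ j) x)))"
      by (metis commute comp_apply funpow_add add.commute)
    then show ?thesis
      using member_le_sum[of "(i, j)" I "\<lambda>(i, j). norm ((A ^^ m) ((B ^^ n) ((A ^^ i) ((B ^^ j) x))))"]
        ij finI by auto
  qed
  moreover have "?s \<longlonglongrightarrow> 0"
    by (rule tendsto_null_sum) (auto simp: norm_mixed_powers_tendsto_0)
  moreover have "0 \<le> supn y" for y
    using norm_le[of y] norm_ge_zero order_trans by blast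
  ultimately show ?thesis
    by (intro tendsto_sandwich[OF _ _ tendsto_const, of _ "\<lambda>n. supn ((A ^^ m) ((B ^^ n) x))" _ ?s]) auto
qed

text \<open>
  For \<open>y = A\<^sup>m B\<^sup>m x\<close> both \<open>A\<^sup>n y\<close> and \<open>B\<^sup>n y\<close> tend to \<open>0\<close>, while \<open>supn y\<close> is at most the larger of
  their two values for every \<open>n\<close>.
\<close>

lemma mixed_power_zero: "(A ^^ m) ((B ^^ m) x) = 0"
proof -
  interpret sw: polynomial_pair_with_sup_norm B A p m supn "prod.swap ` I"
    by (rule swap)
  let ?y = "(A ^^ m) ((B ^^ m) x)"
  have 1: "(A ^^ n) ?y = (B ^^ m) ((A ^^ n) ((A ^^ m) x))" for n
    by (simp add: commute)
  have 2: "(B ^^ n) ?y = (A ^^ m) ((B ^^ n) ((B ^^ m) x))" for n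
    by (simp add: commute)
  have "(\<lambda>n. max (supn ((A ^^ n) ?y)) (supn ((B ^^ n) ?y))) \<longlonglongrightarrow> max 0 0"
    unfolding 1 2
    by (intro tendsto_max supn_mixed_powers_tendsto_0 sw.supn_mixed_powers_tendsto_0)
  then have "supn ?y \<le> max 0 0"
    by (rule LIMSEQ_le_const) (use supn_le_max_pow in auto)
  then show ?thesis
    using norm_le[of ?y] by (metis max.idem norm_le_zero_iff order_trans)
qed

text \<open>
  In a word of length at least \<open>2m\<close> one of the two letters occurs at least \<open>m\<close> times, so the word
  kills \<open>u\<close> or \<open>v\<close>. Hence \<open>Q n (u + v) - Q n u - Q n v\<close> vanishes for large \<open>n\<close>; as a polynomial it
  vanishes at \<open>n = 0\<close> too.
\<close>

lemma norm_powr_additive: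
  assumes u: "(B ^^ m) u = 0" and v: "(A ^^ m) v = 0"
  shows "norm (u + v) powr p = norm u powr p + norm v powr p"
proof -
  let ?Q = "orbit_sum A B p"
  have zero: "(A ^^ i) 0 = 0" "(B ^^ i) 0 = 0" for i
    using linear_0[OF linear_powers(1)] linear_0[OF linear_powers(2)] by auto
  have uz: "(A ^^ j) ((B ^^ k) u) = 0" if "k \<ge> m" for j k
  proof -
    have "(B ^^ k) u = (B ^^ (k - m)) ((B ^^ m) u)"
      using that by (metis comp_apply funpow_add le_add_diff_inverse2)
    then show ?thesis by (simp add: u zero)
  qed
  have vz: "(A ^^ j) ((B ^^ k) v) = 0" if "j \<ge> m" for j k
  proof -
    have "(A ^^ j) v = (A ^^ (j - m)) ((A ^^ m) v)"
      using that by (metis comp_apply funpow_add le_add_diff_inverse2)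
    then show ?thesis by (simp add: v zero commute)
  qed
  have add: "(A ^^ j) ((B ^^ k) (u + v)) = (A ^^ j) ((B ^^ k) u) + (A ^^ j) ((B ^^ k) v)" for j k
    by (simp add: linear_add[OF linear_powers(1)] linear_add[OF linear_powers(2)])
  have "?Q n (u + v) = ?Q n u + ?Q n v" if "n \<ge> 2 * m" for n
    unfolding orbit_sum_eq binomial_sum_add[symmetric]
  proof (rule binomial_sum_cong)
    fix j k :: nat
    assume "j + k = n"
    with that consider "k \<ge> m" | "j \<ge> m" by linarith
    then show "norm ((A ^^ j) ((B ^^ k) (u + v))) powr p =
        norm ((A ^^ j) ((B ^^ k) u)) powr p + norm ((A ^^ j) ((B ^^ k) v)) powr p"
      by cases (use p_pos in \<open>simp_all add: add uz vz\<close>)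
  qed
  then have eventually: "?Q n (u + v) - ?Q n u - ?Q n v = 0" if "n \<ge> 2 * m" for n
    using that by simp
  have "polynomial_seq m (\<lambda>n. ?Q n (u + v) - ?Q n u - ?Q n v)"
    by (rule polynomial_seq_diff[OF polynomial_seq_diff[OF poly poly] poly])
  then have "?Q 0 (u + v) - ?Q 0 u - ?Q 0 v = 0"
    by (rule polynomial_seq_eventually_zero[where N = "2 * m"]) (rule eventually)
  then show ?thesis by simp
qed

lemma supn_scaleR_le:
  assumes "c \<ge> 0"
  shows "supn (c *\<^sub>R x) \<le> c * supn x"
proof -
  obtain i j where "supn (c *\<^sub>R x) = norm ((A ^^ i) ((B ^^ j) (c *\<^sub>R x)))"
    using attained by blast
  also have "\<dots> = c * norm ((A ^^ i) ((B ^^ j) x))"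
    using assms by (simp add: linear_scale[OF linear_powers(1)] linear_scale[OF linear_powers(2)])
  also have "\<dots> \<le> c * supn x"
    using assms norm_le decr_pow by (intro mult_left_mono) (metis order_trans)+
  finally show ?thesis .
qed

text \<open>
  Otherwise there are nonzero vectors \<open>u'\<close>, \<open>v'\<close> in the two kernels with \<open>supn u' = norm u'\<close> and
  \<open>supn v' \<le> norm u'\<close>. On the one hand \<open>norm (u' + v')\<close> is at most \<open>max (supn u') (supn v')\<close>, that
  is, \<open>norm u'\<close>; on the other hand its \<open>p\<close>-th power exceeds that of \<open>norm u'\<close> by the \<open>p\<close>-th power of
  \<open>norm v'\<close>.
\<close>

lemma kernel_trivial:
  assumes u: "(B ^^ m) u = 0" and v: "(A ^^ m) v = 0"
  shows "u = 0 \<or> v = 0"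
proof (rule ccontr)
  assume "\<not> (u = 0 \<or> v = 0)"
  then have "u \<noteq> 0" "v \<noteq> 0" by auto
  obtain i j where ij: "supn u = norm ((A ^^ i) ((B ^^ j) u))"
    using attained by blast
  \<comment> \<open>The word at which \<open>supn u\<close> is attained moves \<open>u\<close> to a vector whose norm equals its \<open>supn\<close>:
    passing to \<open>u'\<close> cannot increase \<open>supn\<close>, and \<open>supn\<close> dominates the norm.\<close>
  define u' where "u' = (A ^^ i) ((B ^^ j) u)"
  have u'_pos: "norm u' > 0"
    using \<open>u \<noteq> 0\<close> ij norm_le[of u] by (auto simp: u'_def)
  have u'_sup: "supn u' \<le> norm u'"
    using decr_pow order_trans ij unfolding u'_def by metis
  have "(B ^^ m) u' = (A ^^ i) ((B ^^ j) ((B ^^ m) u))"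
    unfolding u'_def by (metis commute comp_apply funpow_add add.commute)
  then have u': "(B ^^ m) u' = 0"
    by (simp add: u linear_0[OF linear_powers(1)] linear_0[OF linear_powers(2)])
  have v_pos: "supn v > 0"
    using \<open>v \<noteq> 0\<close> norm_le[of v] by (meson less_le_trans zero_less_norm_iff)
  define v' where "v' = (norm u' / supn v) *\<^sub>R v"
  have v'_sup: "supn v' \<le> norm u'"
    using supn_scaleR_le[of "norm u' / supn v" v] v_pos by (simp add: v'_def)
  have v'_pos: "norm v' > 0"
    using u'_pos v_pos \<open>v \<noteq> 0\<close> by (simp add: v'_def)
  have v': "(A ^^ m) v' = 0"
    by (simp add: v'_def linear_scale[OF linear_powers(1)] v)
  have "norm (u' + v') \<le> norm u'"
  proof -
    \<comment> \<open>\<open>A\<^sup>m\<close> sees only \<open>u'\<close> and \<open>B\<^sup>m\<close> only \<open>v'\<close>, so the maximum formula separates the two.\<close>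
    have "(A ^^ m) (u' + v') = (A ^^ m) u'" "(B ^^ m) (u' + v') = (B ^^ m) v'"
      by (simp_all add: linear_add[OF linear_powers(1)] linear_add[OF linear_powers(2)] u' v')
    then have "supn (u' + v') \<le> max (supn ((A ^^ m) u')) (supn ((B ^^ m) v'))"
      using supn_le_max_pow[of "u' + v'" m] by simp
    also have "\<dots> \<le> norm u'"
      using decr_pow u'_sup v'_sup by (meson max.boundedI order_trans)
    finally show ?thesis
      using norm_le order_trans by blast
  qed
  then have "norm (u' + v') powr p \<le> norm u' powr p"
    using p_pos by (simp add: powr_mono2)
  moreover have "norm v' powr p > 0"
    using v'_pos by simp
  ultimately show False
    using norm_powr_additive[OF u' v'] by linarith
qed

text \<open>
  The range of each of \<open>A\<^sup>m\<close>, \<open>B\<^sup>m\<close> lies in the kernel of the other, and one of the kernels is zero.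
\<close>

lemma power_zero_dichotomy: "(\<forall>x. (A ^^ m) x = 0) \<or> (\<forall>x. (B ^^ m) x = 0)"
  using kernel_trivial mixed_power_zero commute by metis

text \<open>
  For \<open>x \<in> ker B\<^sup>k\<^sup>+\<^sup>1\<close> and \<open>l > 0\<close> the vector \<open>B\<^sup>l x\<close> lies in \<open>ker B\<^sup>k\<close>, where \<open>A\<close> already preserves
  norms. So \<open>Q n (A x)\<close> and \<open>Q n x\<close> differ only in the summand of the word \<open>A\<^sup>n\<close>, which exhibits the
  difference of \<open>n \<mapsto> norm (A\<^sup>n x) powr p\<close> as a polynomial.
\<close>

lemma norm_pow_eq_on_kernel: "(B ^^ k) x = 0 \<Longrightarrow> norm ((A ^^ n) x) = norm x"
proof (induction k arbitrary: x n)
  case 0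
  then show ?case by (simp add: linear_0[OF linear_powers(1)])
next
  case (Suc k)
  let ?g = "\<lambda>n. norm ((A ^^ n) x) powr p"
  have inner: "norm ((A ^^ j) ((B ^^ l) x)) = norm ((B ^^ l) x)" if "l > 0" for j l
  proof -
    have "(B ^^ k) ((B ^^ l) x) = (B ^^ (l - 1)) ((B ^^ Suc k) x)"
    proof -
      have "k + l = (l - 1) + Suc k" using that by simp
      then show ?thesis by (metis comp_apply funpow_add)
    qed
    then show ?thesis
      using Suc by (simp add: linear_0[OF linear_powers(2)])
  qed
  have g_diff: "?g (Suc n) - ?g n = orbit_sum A B p n (A x) - orbit_sum A B p n x" for n
  proof -
    have "(\<Sum>j\<le>n. real (n choose j) * (norm ((A ^^ j) ((B ^^ (n - j)) (A x))) powr p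
            - norm ((A ^^ j) ((B ^^ (n - j)) x)) powr p))
        = (\<Sum>j\<in>{n}. real (n choose j) * (norm ((A ^^ j) ((B ^^ (n - j)) (A x))) powr p
            - norm ((A ^^ j) ((B ^^ (n - j)) x)) powr p))"
    proof (rule sum.mono_neutral_right)
      show "\<forall>j\<in>{..n} - {n}. real (n choose j) * (norm ((A ^^ j) ((B ^^ (n - j)) (A x))) powr p
            - norm ((A ^^ j) ((B ^^ (n - j)) x)) powr p) = 0"
      proof
        fix j assume "j \<in> {..n} - {n}"
        then have "n - j > 0" by auto
        moreover have "(A ^^ j) ((B ^^ (n - j)) (A x)) = (A ^^ Suc j) ((B ^^ (n - j)) x)"
          using commute[of 1 "n - j" x] by (simp add: funpow_swap1)
        ultimately show "real (n choose j) * (norm ((A ^^ j) ((B ^^ (n - j)) (A x))) powr p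
            - norm ((A ^^ j) ((B ^^ (n - j)) x)) powr p) = 0"
          by (simp only: inner) simp
      qed
    qed auto
    then show ?thesis
      by (simp add: orbit_sum_eq binomial_sum_def sum_subtractf right_diff_distrib funpow_swap1)
  qed
  have "polynomial_seq (Suc m) ?g"
    by (simp only: polynomial_seq.simps g_diff) (intro polynomial_seq_diff poly)
  moreover have "\<bar>?g n\<bar> \<le> supn x powr p" for n
    using p_pos norm_le[of "(A ^^ n) x"] decr_pow(1)[of n x] by (simp add: powr_mono2)
  ultimately have "?g n = ?g 0"
    by (rule polynomial_seq_bounded_const)
  then have "norm ((A ^^ n) x) powr p = norm x powr p"
    by simp
  then show ?case
    using p_pos by (metis norm_ge_zero powr_less_mono2 less_irrefl linorder_neqE_linordered_idom)
qed

lemma isometric_if_power_zero: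
  assumes "\<forall>x. (B ^^ m) x = 0"
  shows "isometric (A ^^ n)"
  using norm_pow_eq_on_kernel[of m] assms by (simp add: isometric_def)

end

section \<open>Isometric pairs\<close>

lemma scale_linear_imp_linear:
  assumes "normed_space_over scale" "Vector_Spaces.linear scale scale S"
  shows "linear S"
proof -
  interpret normed_space_over scale by fact
  interpret S: Vector_Spaces.linear scale scale S by fact
  show ?thesis
    by (rule linearI) (simp_all add: S.add S.scale scale_of_real[symmetric])
qed

lemma multi_index_sum_eq_orbit_sum:
  assumes "\<And>x. A (B x) = B (A x)"
  shows "(\<Sum>\<alpha> | mi_abs \<alpha> = k. fact k / real (mi_fact \<alpha>) * norm (op_pow (A, B) \<alpha> x) powr p) =
    orbit_sum A B p k x"
proof -
  have "(\<Sum>\<alpha> | mi_abs \<alpha> = k. fact k / real (mi_fact \<alpha>) * norm (op_pow (A, B) \<alpha> x) powr p) =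
      (\<Sum>j\<le>k. real (k choose j) * norm ((A ^^ j) ((B ^^ (k - j)) x)) powr p)"
    by (rule sum.reindex_bij_witness[where i = "\<lambda>j. (j, k - j)" and j = fst])
      (auto simp: mi_abs_def mi_fact_def op_pow_def binomial_fact)
  then show ?thesis
    using orbit_sum_eq_binomial_sum[of A B p k x] assms by (simp add: binomial_sum_def)
qed

lemma mp_isometric_pair_polynomial_seq:
  assumes "mp_isometric_pair scale m p (A, B)"
  shows "polynomial_seq m (\<lambda>n. orbit_sum A B p n x)"
proof (rule polynomial_seq_orbit_sum)
  fix x
  have comm: "A (B y) = B (A y)" for y
    using assms by (auto simp: mp_isometric_pair_def commuting_pair_def fun_eq_iff)
  have "(\<Sum>k=0..m. (-1) ^ (m - k) * real (m choose k) *
      (\<Sum>\<alpha> | mi_abs \<alpha> = k. fact k / real (mi_fact \<alpha>) * norm (op_pow (A, B) \<alpha> x) powr p)) = 0"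
    using assms unfolding mp_isometric_pair_def by blast
  then show "binomial_sum (\<lambda>j k. (-1) ^ k * orbit_sum A B p j x) m = 0"
    unfolding multi_index_sum_eq_orbit_sum[of A B, OF comm] binomial_sum_def atLeast0AtMost
    by (simp add: mult_ac)
qed

text \<open>
  The function \<open>|x|\<close> attached to a \<open>(\<mu>, \<infinity>)\<close>-isometric pair.
\<close>

definition orbit_max :: "nat \<Rightarrow> ('a::real_normed_vector \<Rightarrow> 'a) \<Rightarrow> ('a \<Rightarrow> 'a) \<Rightarrow> 'a \<Rightarrow> real" where
  "orbit_max \<mu> A B x = Max ((\<lambda>\<alpha>. norm (op_pow (A, B) \<alpha> x)) ` {\<alpha>. mi_abs \<alpha> \<le> \<mu>})"

lemma norm_op_pow_le_orbit_max:
  "mi_abs \<alpha> \<le> \<mu> \<Longrightarrow> norm (op_pow (A, B) \<alpha> x) \<le> orbit_max \<mu> A B x"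
  unfolding orbit_max_def using finite_mi_abs_le by (intro Max_ge) auto

text \<open>
  The equality of the even and the odd maximum means that the overall maximum is attained at a
  multi-index of each prescribed parity \<open>e\<close>. Both maxima are over nonempty sets, the odd one
  because \<open>\<mu> \<ge> 1\<close>.
\<close>

lemma orbit_max_attained:
  assumes "mu_inf_isometric_pair scale \<mu> (A, B)" "\<mu> \<ge> 1"
  shows "\<exists>\<alpha>. mi_abs \<alpha> \<le> \<mu> \<and> even (mi_abs \<alpha>) = e \<and> orbit_max \<mu> A B x = norm (op_pow (A, B) \<alpha> x)"
proof -
  let ?N = "\<lambda>\<alpha>. norm (op_pow (A, B) \<alpha> x)"
  let ?S = "\<lambda>e. ?N ` {\<alpha>. mi_abs \<alpha> \<le> \<mu> \<and> even (mi_abs \<alpha>) = e}"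
  have fin: "finite (?S e)" for e
    by (rule finite_imageI, rule finite_subset[OF _ finite_mi_abs_le[of \<mu>]]) auto
  have "(0, 0) \<in> {\<alpha>. mi_abs \<alpha> \<le> \<mu> \<and> even (mi_abs \<alpha>) = True}"
    "(0, 1) \<in> {\<alpha>. mi_abs \<alpha> \<le> \<mu> \<and> even (mi_abs \<alpha>) = False}"
    using assms(2) by (simp_all add: mi_abs_def)
  then have ne: "?S e \<noteq> {}" for e
    by (cases e) blast+
  have "Max {?N \<alpha> |\<alpha>. mi_abs \<alpha> \<le> \<mu> \<and> even (mi_abs \<alpha>)} =
      Max {?N \<alpha> |\<alpha>. mi_abs \<alpha> \<le> \<mu> \<and> odd (mi_abs \<alpha>)}"
    using assms(1) unfolding mu_inf_isometric_pair_def by blast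
  moreover have "{?N \<alpha> |\<alpha>. mi_abs \<alpha> \<le> \<mu> \<and> even (mi_abs \<alpha>)} = ?S True"
    "{?N \<alpha> |\<alpha>. mi_abs \<alpha> \<le> \<mu> \<and> odd (mi_abs \<alpha>)} = ?S False"
    by auto
  ultimately have "Max (?S True) = Max (?S False)"
    by (simp only:)
  moreover have "?N ` {\<alpha>. mi_abs \<alpha> \<le> \<mu>} = ?S True \<union> ?S False"
    by auto
  then have "orbit_max \<mu> A B x = max (Max (?S True)) (Max (?S False))"
    unfolding orbit_max_def by (simp only: Max_Un[OF fin ne fin ne])
  ultimately have "orbit_max \<mu> A B x = Max (?S e)"
    by (cases e) simp_all
  then show ?thesis
    using Max_in[OF fin ne, of e] by auto
qed

text \<open>
  The freedom to choose the parity is used twice. Choosing the parity opposite to that of \<open>\<mu>\<close>, the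
  maximum is attained at a length below \<open>\<mu>\<close>; a word attaining \<open>|A x|\<close> can then be extended by \<open>A\<close>
  within the length bound, so \<open>|A x| \<le> |x|\<close>. Choosing odd length, the word attaining \<open>|x|\<close> is not
  empty, so one letter can be split off and \<open>|x| \<le> |A x|\<close> or \<open>|x| \<le> |B x|\<close>.
\<close>

lemma polynomial_pair_if_isometric_pairs:
  assumes sp: "normed_space_over scale" and p: "p > 0" and mu: "\<mu> \<ge> 1"
    and mp: "mp_isometric_pair scale m p (A, B)" and inf: "mu_inf_isometric_pair scale \<mu> (A, B)"
  shows "polynomial_pair_with_sup_norm A B p m (orbit_max \<mu> A B) {\<alpha>. mi_abs \<alpha> \<le> \<mu>}"
proof -
  let ?f = "orbit_max \<mu> A B"
  have comm: "A (B x) = B (A x)" for x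
    using mp by (auto simp: mp_isometric_pair_def commuting_pair_def fun_eq_iff)
  have shift: "op_pow (A, B) (i, j) (A x) = op_pow (A, B) (Suc i, j) x"
    "op_pow (A, B) (i, j) (B x) = op_pow (A, B) (i, Suc j) x" for i j x
    using funpow_commute[of A B 1 j x] comm by (simp_all add: op_pow_def funpow_swap1)
  show ?thesis
  proof (rule polynomial_pair_with_sup_norm.intro)
    show "linear A" "linear B"
      using scale_linear_imp_linear[OF sp] mp by (auto simp: mp_isometric_pair_def)
    show "polynomial_seq m (\<lambda>n. orbit_sum A B p n x)" for x
      using mp by (rule mp_isometric_pair_polynomial_seq)
    show "norm x \<le> ?f x" for x
      using norm_op_pow_le_orbit_max[of "(0, 0)" \<mu> A B x] by (simp add: mi_abs_def op_pow_def)
    show "\<exists>(i, j)\<in>{\<alpha>. mi_abs \<alpha> \<le> \<mu>}. ?f x = norm ((A ^^ i) ((B ^^ j) x))" for x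
      using orbit_max_attained[OF inf mu, of True x] by (auto simp: op_pow_def)
    show "?f (A x) \<le> ?f x" "?f (B x) \<le> ?f x" for x
    proof -
      have low: "\<exists>i j. Suc (i + j) \<le> \<mu> \<and> ?f y = norm (op_pow (A, B) (i, j) y)" for y
      proof -
        obtain i j where "mi_abs (i, j) \<le> \<mu>" "even (mi_abs (i, j)) = odd \<mu>"
          "?f y = norm (op_pow (A, B) (i, j) y)"
          using orbit_max_attained[OF inf mu, of "odd \<mu>" y] by auto
        moreover from this have "i + j \<noteq> \<mu>"
          by (auto simp: mi_abs_def)
        ultimately show ?thesis
          by (intro exI[of _ i] exI[of _ j]) (auto simp: mi_abs_def)
      qed
      obtain i j where "Suc (i + j) \<le> \<mu>" "?f (A x) = norm (op_pow (A, B) (i, j) (A x))"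
        using low by blast
      then show "?f (A x) \<le> ?f x"
        using norm_op_pow_le_orbit_max[of "(Suc i, j)" \<mu> A B x] by (simp add: shift mi_abs_def)
      obtain i j where "Suc (i + j) \<le> \<mu>" "?f (B x) = norm (op_pow (A, B) (i, j) (B x))"
        using low by blast
      then show "?f (B x) \<le> ?f x"
        using norm_op_pow_le_orbit_max[of "(i, Suc j)" \<mu> A B x] by (simp add: shift mi_abs_def)
    qed
    show "?f x \<le> max (?f (A x)) (?f (B x))" for x
    proof -
      obtain i j where ij: "i + j \<le> \<mu>" "odd (i + j)" "?f x = norm (op_pow (A, B) (i, j) x)"
        using orbit_max_attained[OF inf mu, of False x] by (auto simp: mi_abs_def)
      show ?thesis
      proof (cases i)
        case (Suc i')
        then have "?f x \<le> ?f (A x)"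
          using ij norm_op_pow_le_orbit_max[of "(i', j)" \<mu> A B "A x"] by (simp add: shift mi_abs_def)
        then show ?thesis by simp
      next
        case 0
        then obtain j' where "j = Suc j'"
          using ij(2) by (cases j) auto
        then have "?f x \<le> ?f (B x)"
          using ij norm_op_pow_le_orbit_max[of "(i, j')" \<mu> A B "B x"] by (simp add: shift mi_abs_def)
        then show ?thesis by simp
      qed
    qed
  qed (use comm p finite_mi_abs_le in auto)
qed

theorem proposition4p3:
  fixes scale :: "'k::real_normed_field \<Rightarrow> 'a::real_normed_vector \<Rightarrow> 'a"
    and m \<mu> :: nat and p :: real
    and T1 T2 :: "'a \<Rightarrow> 'a"
  assumes "normed_space_over scale"
    and "p > 0"
    and "\<mu> \<ge> 1"
    and "bounded_operator scale T1" "bounded_operator scale T2"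
    and "commuting_pair (T1, T2)"
    and "mp_isometric_pair scale m p (T1, T2)"
    and "mu_inf_isometric_pair scale \<mu> (T1, T2)"
  shows "(isometric (T1 ^^ m) \<and> T2 ^^ m = (\<lambda>x. 0)) \<or>
         (isometric (T2 ^^ m) \<and> T1 ^^ m = (\<lambda>x. 0))"
proof -
  interpret polynomial_pair_with_sup_norm T1 T2 p m "orbit_max \<mu> T1 T2" "{\<alpha>. mi_abs \<alpha> \<le> \<mu>}"
    using assms by (intro polynomial_pair_if_isometric_pairs)
  interpret swapped: polynomial_pair_with_sup_norm T2 T1 p m "orbit_max \<mu> T1 T2"
    "prod.swap ` {\<alpha>. mi_abs \<alpha> \<le> \<mu>}"
    by (rule swap)
  show ?thesis
    using power_zero_dichotomy isometric_if_power_zero swapped.isometric_if_power_zero by blast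
qed

end
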